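(* Let $y_1,y_2,\dots$ be commuting variables and give each $\alpha\in\mathrm{DUPF}_n$ the weight $y(\alpha):=\prod_{j=1}^{m(\alpha)}y_{\ell_j}$, where $\ell_1,\dots,\ell_{m(\alpha)}$ are the block lengths of $\alpha$. Then, as formal power series, $$\sum_{n\ge0}\Bigl(\sum_{\alpha\in\mathrm{DUPF}_n}y(\alpha)\Bigr)\frac{x^n}{n!}=D\Bigl(\sum_{j\ge1}y_j\frac{x^j}{j!}\Bigr),\qquad D(z)=\frac{e^{-z}}{1-z}.$$
   Context: $[n]=\{1,\dots,n\}$. A tuple $\alpha=(a_1,\dots,a_n)\in[n]^n$ is a parking function if, when cars $1,\dots,n$ enter in this order a one-way street with spots $1,\dots,n$ and car $i$ parks in the first free spot $s_i\ge a_i$, all cars manage to park. $\mathrm{UPF}_n$ (unit-interval parking functions) is the set of parking functions of length $n$ with $s_i-a_i\in\{0,1\}$ for all $i$; $\mathrm{UPF}_0$ consists of the empty tuple. Block structure: for $\alpha\in\mathrm{UPF}_n$ let $(a^\uparrow_1,\dots,a^\uparrow_n)$ be its weakly increasing rearrangement, let $\nu_1<\dots<\nu_m$ be the indices $i$ with $a^\uparrow_i=i$ (block starts), put $\nu_{m+1}=n+1$, $\ell_j=\nu_{j+1}-\nu_j$ (length of block $j$), and $m(\alpha)=m$. The car set of block $j$ is $I_j=\{i\in[n]:\nu_j\le a_i<\nu_{j+1}\}$, and $|I_j|=\ell_j$. Set $\phi(\alpha)=(I_1,\dots,I_m)$, an ordered set partition of $[n]$. An ordered set partition $(C_1,\dots,C_k)$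 of $[n]$ (nonempty disjoint blocks with union $[n]$), whose blocks listed by increasing minimum element are $B_1,\dots,B_k$, is deranged if $C_i\ne B_i$ for all $i\in[k]$ (the empty ordered set partition of $\emptyset$ is deranged). $\mathrm{DUPF}_n$ is the set of $\alpha\in\mathrm{UPF}_n$ such that $\phi(\alpha)$ is deranged; $\mathrm{DUPF}_0=\mathrm{UPF}_0$. *)

theory Defs
  imports "HOL-Library.Poly_Mapping" "HOL-Computational_Algebra.Formal_Power_Series"
begin

text \<open>
  A tuple \<open>(a\<^sub>1,\<dots>,a\<^sub>n)\<close> is a list of length \<open>n\<close>. Spots, cars and block starts are numbered
  from 1 as on paper, while list indices start at 0, so the preference of car \<open>i\<close> is
  \<open>\<alpha> ! (i - 1)\<close>.
\<close>

text \<open>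
  \<open>park n occ as\<close> lets the cars with preferences \<open>as\<close> enter in this order a street with spots
  \<open>1,\<dots>,n\<close>, of which those in \<open>occ\<close> are taken. It returns the list of spots \<open>s\<^sub>i\<close> where the
  cars park, or \<open>None\<close> if some car finds no free spot.
\<close>

fun park :: "nat \<Rightarrow> nat set \<Rightarrow> nat list \<Rightarrow> nat list option" where
  "park n occ [] = Some []"
| "park n occ (a # as) =
    (let free = {s \<in> {1..n}. a \<le> s \<and> s \<notin> occ} in
     if free = {} then None
     else map_option (\<lambda>ss. Min free # ss) (park n (insert (Min free) occ) as))"

definition PF :: "nat \<Rightarrow> nat list set" where
  "PF n = {\<alpha>. length \<alpha> = n \<and> set \<alpha> \<subseteq> {1..n} \<and> park n {} \<alpha> \<noteq> None}"

definition UPF :: "nat \<Rightarrow> nat list set" where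
  "UPF n = {\<alpha> \<in> PF n. \<forall>i<n. the (park n {} \<alpha>) ! i \<in> {\<alpha> ! i, \<alpha> ! i + 1}}"

definition block_starts :: "nat list \<Rightarrow> nat list" where
  "block_starts \<alpha> = filter (\<lambda>i. sort \<alpha> ! (i - 1) = i) [1..<length \<alpha> + 1]"

definition num_blocks :: "nat list \<Rightarrow> nat" where
  "num_blocks \<alpha> = length (block_starts \<alpha>)"

text \<open>The list \<open>\<nu>\<^sub>1,\<dots>,\<nu>\<^sub>m,\<nu>\<^sub>m\<^sub>+\<^sub>1\<close> with \<open>\<nu>\<^sub>m\<^sub>+\<^sub>1 = n + 1\<close>.\<close>

definition block_bounds :: "nat list \<Rightarrow> nat list" where
  "block_bounds \<alpha> = block_starts \<alpha> @ [length \<alpha> + 1]"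

text \<open>In the next two definitions blocks are indexed by \<open>j < num_blocks \<alpha>\<close>.\<close>

definition block_length :: "nat list \<Rightarrow> nat \<Rightarrow> nat" where
  "block_length \<alpha> j = block_bounds \<alpha> ! Suc j - block_bounds \<alpha> ! j"

definition car_set :: "nat list \<Rightarrow> nat \<Rightarrow> nat set" where
  "car_set \<alpha> j = {i \<in> {1..length \<alpha>}.
     block_bounds \<alpha> ! j \<le> \<alpha> ! (i - 1) \<and> \<alpha> ! (i - 1) < block_bounds \<alpha> ! Suc j}"

definition phi :: "nat list \<Rightarrow> nat set list" where
  "phi \<alpha> = map (car_set \<alpha>) [0..<num_blocks \<alpha>]"

text \<open>
  Applied only to ordered set partitions of some \<open>{1..n}\<close>, whose blocks are finite, nonempty and
  have pairwise distinct minima; \<open>sort_key Min Cs\<close> lists the blocks by increasing minimum.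
\<close>

definition deranged :: "nat set list \<Rightarrow> bool" where
  "deranged Cs \<longleftrightarrow> (\<forall>i<length Cs. Cs ! i \<noteq> sort_key Min Cs ! i)"

definition DUPF :: "nat \<Rightarrow> nat list set" where
  "DUPF n = {\<alpha> \<in> UPF n. deranged (phi \<alpha>)}"

text \<open>
  The polynomial ring \<open>\<rat>[y\<^sub>0, y\<^sub>1, y\<^sub>2, \<dots>]\<close>: finitely supported maps from monomials (exponent
  vectors of finite support) to coefficients, with the convolution product of
  \<^theory>\<open>HOL-Library.Poly_Mapping\<close>. The variable \<open>y\<^sub>0\<close> is never used.
\<close>

type_synonym ypoly = "(nat \<Rightarrow>\<^sub>0 nat) \<Rightarrow>\<^sub>0 rat"

definition yvar :: "nat \<Rightarrow> ypoly" where
  "yvar j = Poly_Mapping.single (Poly_Mapping.single j 1) 1"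

definition yconst :: "rat \<Rightarrow> ypoly" where
  "yconst c = Poly_Mapping.single 0 c"

definition yweight :: "nat list \<Rightarrow> ypoly" where
  "yweight \<alpha> = (\<Prod>j<num_blocks \<alpha>. yvar (block_length \<alpha> j))"

definition Dseries :: "rat fps" where
  "Dseries = fps_exp (- 1) / (1 - fps_X)"

text \<open>Extension of scalars from \<open>\<rat>\<close> to \<open>\<rat>[y\<^sub>0, y\<^sub>1, \<dots>]\<close>.\<close>

definition fps_yconst :: "rat fps \<Rightarrow> ypoly fps" where
  "fps_yconst F = Abs_fps (\<lambda>n. yconst (fps_nth F n))"

text \<open>\<open>egf c = \<Sum>\<^sub>n c\<^sub>n x\<^sup>n / n!\<close> as a formal power series in \<open>x\<close> over \<open>\<rat>[y\<^sub>0, y\<^sub>1, \<dots>]\<close>.\<close>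

definition egf :: "(nat \<Rightarrow> ypoly) \<Rightarrow> ypoly fps" where
  "egf c = Abs_fps (\<lambda>n. c n * yconst (1 / fact n))"

end

theory Submission
  imports Defs "HOL-Combinatorics.Multiset_Permutations" "HOL-Library.Disjoint_Sets"
begin

text \<open>
  The map \<open>\<phi>\<close> is a bijection from unit interval parking functions to ordered set partitions: the
  spot of each car and the set of cars parked on their preferred spot determine the tuple, and a
  spot is a block start iff its car got its preference, while inside a block the cars park in
  increasing order. Hence the \<open>i\<close>-th tuple entry is \<open>\<nu>\<^sub>j + max (r - 1) 0\<close>, where \<open>r\<close> is the number of
  smaller cars in the block \<open>I\<^sub>j\<close> of \<open>i\<close>.

  Under \<open>\<phi>\<close> the weight only depends on the underlying unordered partition. Among the \<open>k!\<close> orderings of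
  a set partition with \<open>k\<close> blocks, exactly \<open>k! [z\<^sup>k] D(z)\<close> are deranged, because classifying all
  permutations by their fixed points multiplies the derangement series by \<open>e\<^sup>z\<close>. So the deranged
  ordered partitions with \<open>k\<close> blocks weigh \<open>[z\<^sup>k] D(z)\<close> times as much as all of them, whose exponential
  generating function is the \<open>k\<close>-th power of the inner series.
\<close>

unbundle fps_syntax

section \<open>Derangements\<close>

text \<open>Subsets are grouped by size. This serves both the derangement count and the binomial
  convolution behind powers of the inner series.\<close>

lemma sum_Pow_card:
  fixes f :: "nat \<Rightarrow> 'a::comm_semiring_1"
  assumes "finite A"
  shows "(\<Sum>S\<in>Pow A. f (card S)) = (\<Sum>k\<le>card A. of_nat (card A choose k) * f k)"
proof -
  have "(\<Sum>S\<in>Pow A. f (card S)) = (\<Sum>k\<le>card A. \<Sum>S\<in>{S \<in> Pow A. card S = k}. f (card S))"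
    using assms by (intro sum.group[symmetric]) (auto intro: card_mono)
  also have "\<dots> = (\<Sum>k\<le>card A. of_nat (card A choose k) * f k)"
    using n_subsets[OF assms] by (intro sum.cong) auto
  finally show ?thesis .
qed

text \<open>Comparison of coefficients in \<open>D(z) * e^z = 1 / (1 - z)\<close>, scaled by
  \<open>n!\<close>.\<close>

lemma sum_choose_Dseries:
  "(\<Sum>k\<le>n. of_nat (n choose k) * (fact k * Dseries $ k)) = fact n"
proof -
  define G :: "rat fps" where "G = Abs_fps (\<lambda>_. 1)"
  have "inverse (1 - fps_X) = G"
    unfolding G_def using fps_inverse_gp'[where ?'a = rat]
    by (metis fps_inverse_idempotent fps_nth_Abs_fps one_neq_zero)
  then have "Dseries = fps_exp (- 1) * G"
    by (simp add: Dseries_def fps_divide_unit)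
  then have "Dseries * fps_exp 1 = fps_exp (- 1) * fps_exp 1 * G"
    by (simp add: mult_ac)
  also have "\<dots> = G"
    using fps_exp_add_mult[of "-1 :: rat" 1] by simp
  finally have "(Dseries * fps_exp 1) $ n = 1"
    by (simp add: G_def)
  then have *: "(\<Sum>k\<le>n. Dseries $ k / fact (n - k)) = 1"
    by (simp add: fps_mult_nth atLeast0AtMost)
  have "(\<Sum>k\<le>n. of_nat (n choose k) * (fact k * Dseries $ k)) =
        (\<Sum>k\<le>n. fact n * (Dseries $ k / fact (n - k)))"
    by (intro sum.cong) (auto simp: binomial_fact)
  also have "\<dots> = fact n"
    unfolding sum_distrib_left[symmetric] * by simp
  finally show ?thesis .
qed

definition derangements :: "'a set \<Rightarrow> ('a \<Rightarrow> 'a) set" where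
  "derangements S = {p. p permutes S \<and> (\<forall>x\<in>S. p x \<noteq> x)}"

text \<open>An element of either set is the identity outside \<open>F\<close>, and
  \<open>permutes\<close> speaks of functions on the whole type, so no restriction map is needed and
  the sets are literally equal.\<close>

lemma permutes_fixing_eq_derangements:
  assumes "F \<subseteq> S"
  shows "{p. p permutes S \<and> {x \<in> S. p x = x} = S - F} = derangements F"
proof (intro equalityI subsetI)
  fix p assume "p \<in> {p. p permutes S \<and> {x \<in> S. p x = x} = S - F}"
  then have p: "p permutes S" "{x \<in> S. p x = x} = S - F" by auto
  have "p permutes F"
    using p by (intro permutes_superset[OF p(1)]) auto
  then show "p \<in> derangements F"
    using p assms by (auto simp: derangements_def)
next
  fix p assume "p \<in> derangements F"
  then show "p \<in> {p. p permutes S \<and> {x \<in> S. p x = x} = S - F}"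
    using assms by (auto simp: derangements_def intro: permutes_subset permutes_not_in)
qed

lemma sum_card_derangements:
  assumes "finite S"
  shows "(\<Sum>F\<in>Pow S. card (derangements F)) = fact (card S)"
proof -
  have fin: "finite {p. p permutes S}"
    using assms by (rule finite_permutations)
  have "fact (card S) = card {p. p permutes S}"
    using card_permutations[OF refl assms] by simp
  also have "\<dots> = (\<Sum>p\<in>{p. p permutes S}. 1)" by simp
  also have "\<dots> = (\<Sum>F\<in>Pow S. \<Sum>p\<in>{p \<in> {p. p permutes S}. S - {x \<in> S. p x = x} = F}. 1)"
    using fin assms by (intro sum.group[symmetric]) auto
  also have "\<dots> = (\<Sum>F\<in>Pow S. card (derangements F))"
  proof (intro sum.cong refl)
    fix F assume "F \<in> Pow S"
    then have "{p \<in> {p. p permutes S}. S - {x \<in> S. p x = x} = F} = derangements F"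
      by (subst permutes_fixing_eq_derangements[of F S, symmetric]) auto
    then show "(\<Sum>p\<in>{p \<in> {p. p permutes S}. S - {x \<in> S. p x = x} = F}. 1) = card (derangements F)"
      by simp
  qed
  finally show ?thesis by simp
qed

text \<open>Both sides, summed over all subsets of a finite set, give the factorial of its size.
  Such a relation determines the summands by induction on proper subsets.\<close>

lemma card_derangements:
  assumes "finite S"
  shows "of_nat (card (derangements S)) = fact (card S) * Dseries $ card S"
  using assms
proof (induction S rule: finite_psubset_induct)
  case (psubset S)
  let ?d = "\<lambda>k. fact k * Dseries $ k"
  have split: "(\<Sum>F\<in>Pow S. h F) = h S + (\<Sum>F\<in>Pow S - {S}. h F)" for h :: "'a set \<Rightarrow> rat"
    using psubset.hyps by (intro sum.remove) auto
  have "(\<Sum>F\<in>Pow S. of_nat (card (derangements F))) = (fact (card S) :: rat)"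
    using arg_cong[OF sum_card_derangements[OF psubset.hyps], of "of_nat :: nat \<Rightarrow> rat"] by simp
  also have "\<dots> = (\<Sum>F\<in>Pow S. ?d (card F))"
    using sum_Pow_card[OF psubset.hyps, of ?d] by (simp only: sum_choose_Dseries)
  finally have "of_nat (card (derangements S)) + (\<Sum>F\<in>Pow S - {S}. of_nat (card (derangements F))) =
      ?d (card S) + (\<Sum>F\<in>Pow S - {S}. ?d (card F))"
    by (simp only: split)
  moreover have "(\<Sum>F\<in>Pow S - {S}. of_nat (card (derangements F))) = (\<Sum>F\<in>Pow S - {S}. ?d (card F))"
    by (intro sum.cong refl psubset.IH) auto
  ultimately show ?case by simp
qed

text \<open>With a reference list \<open>bs\<close> fixed, orderings of a set become permutations of
  it. Surjectivity comes from counting: both sides have the same factorial size.\<close>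

lemma bij_betw_map_permutes:
  assumes "distinct bs"
  shows "bij_betw (\<lambda>p. map p bs) {p. p permutes set bs} (permutations_of_set (set bs))"
proof (rule bij_betw_imageI)
  show inj: "inj_on (\<lambda>p. map p bs) {p. p permutes set bs}"
  proof (rule inj_onI, rule ext)
    fix p q x
    assume pq: "p \<in> {p. p permutes set bs}" "q \<in> {p. p permutes set bs}" "map p bs = map q bs"
    show "p x = q x"
      using pq by (cases "x \<in> set bs") (auto simp: permutes_not_in)
  qed
  show "(\<lambda>p. map p bs) ` {p. p permutes set bs} = permutations_of_set (set bs)"
  proof (rule card_subset_eq)
    show "(\<lambda>p. map p bs) ` {p. p permutes set bs} \<subseteq> permutations_of_set (set bs)"
      using assms by (auto simp: permutations_of_set_def permutes_image distinct_map permutes_inj_on)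
    show "card ((\<lambda>p. map p bs) ` {p. p permutes set bs}) = card (permutations_of_set (set bs))"
      using inj by (simp add: card_image card_permutations)
  qed simp
qed

section \<open>Weighted ordered set partitions\<close>

definition osp :: "'a set \<Rightarrow> 'a set list set" where
  "osp A = {Cs. distinct Cs \<and> partition_on A (set Cs)}"

lemma finite_partition_on:
  assumes "finite A" "partition_on A P" shows "finite P"
  using assms finite_elements by blast

text \<open>A common minimum would lie in two disjoint blocks. This makes the sorted order of the
  blocks unambiguous and later bounds their number.\<close>

lemma inj_on_Min_partition:
  fixes A :: "'a::linorder set"
  assumes "finite A" "partition_on A P"
  shows "inj_on Min P"
proof (rule inj_onI)
  fix B C assume BC: "B \<in> P" "C \<in> P" "Min B = Min C"
  have "finite B" "B \<noteq> {}" "finite C" "C \<noteq> {}"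
    using BC assms by (auto simp: partition_on_def intro: finite_subset)
  then have "Min B \<in> B \<inter> C"
    using BC(3) Min_in by (metis IntI)
  then show "B = C"
    using partition_onD2[OF assms(2)] BC by (auto simp: disjoint_def)
qed

text \<open>Relative to the list \<open>bs\<close> of blocks by increasing minimum, the ordering
  \<open>map p bs\<close> is deranged exactly when \<open>p\<close> has no fixed point in
  \<open>P\<close>.\<close>

lemma card_deranged:
  assumes "finite A" "partition_on A P"
  shows "of_nat (card {Cs \<in> permutations_of_set P. deranged Cs}) =
    fact (card P) * Dseries $ card P"
proof -
  have fin: "finite P" using assms by (rule finite_partition_on)
  then obtain xs where xs: "set xs = P" "distinct xs"
    using finite_distinct_list by blast
  define bs where "bs = sort_key Min xs"
  have bs: "set bs = P" "distinct bs"
    using xs by (auto simp: bs_def)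
  \<comment> \<open>Distinct minima leave no ties, so the sorted list is the same for every ordering
    of \<open>P\<close>.\<close>
  have sort: "sort_key Min Cs = bs" if "Cs \<in> permutations_of_set P" for Cs
  proof -
    have "mset Cs = mset xs"
      using that xs by (metis permutations_of_setD(1,2) set_eq_iff_mset_eq_distinct)
    then show ?thesis
      unfolding bs_def using that inj_on_Min_partition[OF assms]
      by (intro sort_key_eq_sort_key) (auto dest: permutations_of_setD)
  qed
  note bij = bij_betw_map_permutes[OF bs(2), unfolded bs(1)]
  have "deranged (map p bs) \<longleftrightarrow> (\<forall>x\<in>P. p x \<noteq> x)" if "p permutes P" for p
  proof -
    have "map p bs \<in> permutations_of_set P"
      using bij that by (auto simp: bij_betw_def)
    then have "deranged (map p bs) \<longleftrightarrow> (\<forall>i<length bs. p (bs ! i) \<noteq> bs ! i)"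
      by (simp add: deranged_def sort)
    then show ?thesis
      using bs(1) by (metis in_set_conv_nth)
  qed
  then have "(\<lambda>p. map p bs) ` derangements P =
      {Cs \<in> (\<lambda>p. map p bs) ` {p. p permutes P}. deranged Cs}"
    by (auto simp: derangements_def)
  then have "bij_betw (\<lambda>p. map p bs) (derangements P) {Cs \<in> permutations_of_set P. deranged Cs}"
    using bij by (auto simp: bij_betw_def derangements_def intro: inj_on_subset)
  then show ?thesis
    using card_derangements[OF fin] by (simp flip: bij_betw_same_card)
qed

lemma finite_partitions: "finite A \<Longrightarrow> finite {P. partition_on A P}"
  by (rule finite_subset[of _ "Pow (Pow A)"]) (auto simp: partition_on_def)

lemma osp_eq_UN: "finite A \<Longrightarrow> osp A = (\<Union>P\<in>{P. partition_on A P}. permutations_of_set P)"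
  by (auto simp: osp_def permutations_of_set_def)

lemma finite_osp: "finite A \<Longrightarrow> finite (osp A)"
  by (simp add: osp_eq_UN finite_partitions)

text \<open>An ordered set partition is an unordered one with an ordering of its blocks. The filter
  \<open>Q\<close> allows the same split with and without the derangement condition.\<close>

lemma sum_osp:
  assumes "finite A"
  shows "(\<Sum>Cs\<in>{Cs \<in> osp A. Q Cs}. h Cs) =
    (\<Sum>P | partition_on A P. \<Sum>Cs\<in>{Cs \<in> permutations_of_set P. Q Cs}. h Cs)"
proof -
  have "{Cs \<in> osp A. Q Cs} = (\<Union>P\<in>{P. partition_on A P}. {Cs \<in> permutations_of_set P. Q Cs})"
    by (auto simp: osp_eq_UN assms)
  then show ?thesis
    using assms finite_partitions
    by (auto simp: permutations_of_set_def intro!: sum.UNION_disjoint finite_subset[OF _ finite_permutations_of_set])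
qed

lemma length_permutations_of_set: "Cs \<in> permutations_of_set P \<Longrightarrow> length Cs = card P"
  by (auto simp: permutations_of_set_def distinct_card)

text \<open>Removing the first block is the recursion that matches multiplication by one more factor
  of the inner series.\<close>

lemma osp_Cons_iff:
  "C # Cs \<in> osp A \<longleftrightarrow> C \<noteq> {} \<and> C \<subseteq> A \<and> Cs \<in> osp (A - C)"
proof
  assume "C # Cs \<in> osp A"
  then show "C \<noteq> {} \<and> C \<subseteq> A \<and> Cs \<in> osp (A - C)"
    by (auto simp: osp_def partition_on_def pairwise_insert disjnt_def)
next
  assume *: "C \<noteq> {} \<and> C \<subseteq> A \<and> Cs \<in> osp (A - C)"
  then have "C \<notin> set Cs"
    by (auto simp: osp_def partition_on_def)
  then show "C # Cs \<in> osp A"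
    using * by (auto simp: osp_def partition_on_def pairwise_insert disjnt_def)
qed

abbreviation osp_weight :: "'a set list \<Rightarrow> ypoly" where
  "osp_weight Cs \<equiv> (\<Prod>C\<leftarrow>Cs. yvar (card C))"

lemma sum_osp_Suc:
  assumes "finite A"
  shows "(\<Sum>Cs\<in>{Cs \<in> osp A. length Cs = Suc k}. osp_weight Cs) =
    (\<Sum>C\<in>Pow A - {{}}. yvar (card C) * (\<Sum>Cs\<in>{Cs \<in> osp (A - C). length Cs = k}. osp_weight Cs))"
proof -
  have "{Cs \<in> osp A. length Cs = Suc k} =
      (\<lambda>(C, Cs). C # Cs) ` (SIGMA C:Pow A - {{}}. {Cs \<in> osp (A - C). length Cs = k})"
    by (auto simp: length_Suc_conv osp_Cons_iff image_iff)
  then have "(\<Sum>Cs\<in>{Cs \<in> osp A. length Cs = Suc k}. osp_weight Cs) =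
      (\<Sum>(C, Cs)\<in>(SIGMA C:Pow A - {{}}. {Cs \<in> osp (A - C). length Cs = k}). osp_weight (C # Cs))"
    by (simp add: sum.reindex inj_on_def split_def)
  also have "\<dots> = (\<Sum>C\<in>Pow A - {{}}. \<Sum>Cs\<in>{Cs \<in> osp (A - C). length Cs = k}. osp_weight (C # Cs))"
    using assms by (intro sum.Sigma[symmetric]) (auto simp: finite_osp)
  finally show ?thesis
    by (simp add: sum_distrib_left)
qed

section \<open>Powers of the inner exponential generating function\<close>

lemma yconst_mult: "yconst (a * b) = yconst a * yconst b"
  by (simp add: yconst_def mult_single)

lemma yconst_of_nat: "yconst (of_nat n) = of_nat n"
  by (simp add: yconst_def)

lemma yconst_1: "yconst 1 = 1"
  by (simp add: yconst_def)

definition Yseries :: "ypoly fps" where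
  "Yseries = egf (\<lambda>j. if j \<ge> 1 then yvar j else 0)"

lemma egf_mult:
  "egf f * egf g = egf (\<lambda>n. \<Sum>k\<le>n. of_nat (n choose k) * (f k * g (n - k)))"
proof (rule fps_ext)
  fix n
  have "yconst (1 / fact k) * yconst (1 / fact (n - k)) = of_nat (n choose k) * yconst (1 / fact n)"
    if "k \<le> n" for k
    using that by (simp add: binomial_fact flip: yconst_of_nat yconst_mult)
  then show "(egf f * egf g) $ n = egf (\<lambda>n. \<Sum>k\<le>n. of_nat (n choose k) * (f k * g (n - k))) $ n"
    unfolding egf_def fps_mult_nth fps_nth_Abs_fps sum_distrib_right atLeast0AtMost
    by (intro sum.cong) (simp_all add: mult_ac)
qed

text \<open>The coefficient function \<open>w\<close> is quantified so that the induction also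
  records that the weighted sum depends on \<open>A\<close> only through its size: after a block is
  removed, the remaining set is arbitrary.\<close>

lemma Yseries_power:
  "\<exists>w. Yseries ^ k = egf w \<and> (\<forall>A :: 'a set. finite A \<longrightarrow>
     (\<Sum>Cs\<in>{Cs \<in> osp A. length Cs = k}. osp_weight Cs) = w (card A))"
proof (induction k)
  case 0
  have "{Cs \<in> osp A. length Cs = 0} = (if A = {} then {[]} else {})" for A :: "'a set"
    by (auto simp: osp_def partition_on_def)
  moreover have "(1 :: ypoly fps) = egf (\<lambda>n. if n = 0 then 1 else 0)"
    by (auto simp: egf_def fps_eq_iff yconst_1)
  ultimately show ?case
    by (intro exI[of _ "\<lambda>n. if n = 0 then 1 else 0"]) auto
next
  case (Suc k)
  then obtain w where w: "Yseries ^ k = egf w"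
    "\<And>A :: 'a set. finite A \<Longrightarrow> (\<Sum>Cs\<in>{Cs \<in> osp A. length Cs = k}. osp_weight Cs) = w (card A)"
    by blast
  let ?y = "\<lambda>j. if j \<ge> 1 then yvar j else 0"
  let ?w = "\<lambda>n. \<Sum>j\<le>n. of_nat (n choose j) * (?y j * w (n - j))"
  have "Yseries ^ Suc k = egf ?w"
    unfolding power_Suc w(1) unfolding Yseries_def egf_mult ..
  moreover have "(\<Sum>Cs\<in>{Cs \<in> osp A. length Cs = Suc k}. osp_weight Cs) = ?w (card A)"
    if A: "finite A" for A :: "'a set"
  proof -
    have "(\<Sum>Cs\<in>{Cs \<in> osp A. length Cs = Suc k}. osp_weight Cs) =
      (\<Sum>C\<in>Pow A - {{}}. ?y (card C) * w (card A - card C))"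
      unfolding sum_osp_Suc[OF A] using A
      by (intro sum.cong refl)
         (auto simp: w(2) card_Diff_subset Suc_le_eq card_gt_0_iff intro: finite_subset)
    \<comment> \<open>The empty block may be readmitted because \<open>?y 0 = 0\<close>.\<close>
    also have "\<dots> = (\<Sum>C\<in>Pow A. ?y (card C) * w (card A - card C))"
      using A by (intro sum.mono_neutral_left) auto
    also have "\<dots> = ?w (card A)"
      by (rule sum_Pow_card[OF A])
    finally show ?thesis .
  qed
  ultimately show ?case by blast
qed

section \<open>From all ordered partitions to the deranged ones\<close>

lemma osp_weight_permutation:
  "Cs \<in> permutations_of_set P \<Longrightarrow> osp_weight Cs = (\<Prod>B\<in>P. yvar (card B))"
  by (auto simp: permutations_of_set_def prod.distinct_set_conv_list)

text \<open>All orderings of one partition have equal weight, so for each partition with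
  \<open>k\<close> blocks the claim compares the number of deranged orderings, \<open>k!\<close>
  times the \<open>k\<close>-th coefficient of \<open>Dseries\<close>, with
  \<open>k!\<close>.\<close>

lemma sum_deranged_osp:
  fixes A :: "nat set"
  assumes "finite A"
  shows "(\<Sum>Cs\<in>{Cs \<in> osp A. length Cs = k \<and> deranged Cs}. osp_weight Cs) =
    yconst (Dseries $ k) * (\<Sum>Cs\<in>{Cs \<in> osp A. length Cs = k}. osp_weight Cs)"
proof -
  let ?w = "\<lambda>P. \<Prod>B\<in>P. yvar (card B)"
  have *: "(\<Sum>Cs\<in>{Cs \<in> permutations_of_set P. length Cs = k \<and> deranged Cs}. osp_weight Cs) =
      yconst (Dseries $ k) * (\<Sum>Cs\<in>{Cs \<in> permutations_of_set P. length Cs = k}. osp_weight Cs)"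
    if P: "partition_on A P" for P
  proof (cases "card P = k")
    case True
    have "finite P" using assms P by (rule finite_partition_on)
    have "{Cs \<in> permutations_of_set P. length Cs = k \<and> deranged Cs} =
          {Cs \<in> permutations_of_set P. deranged Cs}"
         "{Cs \<in> permutations_of_set P. length Cs = k} = permutations_of_set P"
      using True by (auto simp: length_permutations_of_set)
    moreover have "(of_nat (card {Cs \<in> permutations_of_set P. deranged Cs}) :: ypoly) =
        yconst (Dseries $ k) * of_nat (fact k)"
      using card_deranged[OF assms P] True
      by (simp add: mult.commute flip: yconst_of_nat yconst_mult)
    moreover have "(\<Sum>Cs\<in>{Cs \<in> permutations_of_set P. R Cs}. osp_weight Cs) =
        of_nat (card {Cs \<in> permutations_of_set P. R Cs}) * ?w P" for R
    proof -
      have "(\<Sum>Cs\<in>{Cs \<in> permutations_of_set P. R Cs}. osp_weight Cs) =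
          (\<Sum>Cs\<in>{Cs \<in> permutations_of_set P. R Cs}. ?w P)"
        by (intro sum.cong) (auto simp: osp_weight_permutation)
      then show ?thesis by simp
    qed
    from this[of deranged] this[of "\<lambda>_. True"]
    have "(\<Sum>Cs\<in>{Cs \<in> permutations_of_set P. deranged Cs}. osp_weight Cs) =
        of_nat (card {Cs \<in> permutations_of_set P. deranged Cs}) * ?w P"
      "(\<Sum>Cs\<in>permutations_of_set P. osp_weight Cs) = of_nat (fact k) * ?w P"
      using True \<open>finite P\<close> by simp_all
    ultimately show ?thesis
      by (simp only: mult.assoc)
  next
    case False
    then have "{Cs \<in> permutations_of_set P. length Cs = k \<and> deranged Cs} = {}"
      "{Cs \<in> permutations_of_set P. length Cs = k} = {}"
      by (auto simp: length_permutations_of_set)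
    then show ?thesis
      by (simp only: sum.empty mult_zero_right)
  qed
  show ?thesis
    unfolding sum_osp[OF assms] sum_distrib_left[of _ _ "{P. partition_on A P}"]
    by (rule sum.cong[OF refl], rule *) simp
qed

text \<open>The block minima are distinct elements of \<open>A\<close>.\<close>

lemma length_osp_le:
  fixes A :: "'a::linorder set"
  assumes "finite A" "Cs \<in> osp A"
  shows "length Cs \<le> card A"
proof -
  have P: "partition_on A (set Cs)" and "distinct Cs"
    using assms(2) by (auto simp: osp_def)
  have "Min B \<in> A" if "B \<in> set Cs" for B
  proof -
    have "B \<subseteq> A" "B \<noteq> {}"
      using that P by (auto simp: partition_on_def)
    then show ?thesis
      using assms(1) by (meson Min_in finite_subset subsetD)
  qed
  then have "card (set Cs) \<le> card A"
    by (intro card_inj_on_le[OF inj_on_Min_partition[OF assms(1) P]]) (auto simp: assms(1))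
  then show ?thesis
    using \<open>distinct Cs\<close> by (simp add: distinct_card)
qed

lemma egf_deranged_osp:
  "egf (\<lambda>n. \<Sum>Cs\<in>{Cs \<in> osp {1..n}. deranged Cs}. osp_weight Cs) = fps_yconst Dseries oo Yseries"
proof (rule fps_ext)
  fix n
  let ?A = "{1..n}" and ?f = "yconst (1 / fact n)"
  have W: "(\<Sum>Cs\<in>{Cs \<in> osp ?A. length Cs = k}. osp_weight Cs) * ?f = (Yseries ^ k) $ n" for k
  proof -
    obtain w where w: "Yseries ^ k = egf w"
      "\<And>A :: nat set. finite A \<Longrightarrow> (\<Sum>Cs\<in>{Cs \<in> osp A. length Cs = k}. osp_weight Cs) = w (card A)"
      using Yseries_power by blast
    show ?thesis by (simp add: w) (simp add: egf_def)
  qed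
  \<comment> \<open>Grouping by the number of blocks, at most \<open>n\<close>, reproduces the
    finite sum over \<open>k\<close> that defines the \<open>n\<close>-th coefficient of a
    composition.\<close>
  have "(\<Sum>Cs\<in>{Cs \<in> osp ?A. deranged Cs}. osp_weight Cs) =
      (\<Sum>k=0..n. \<Sum>Cs\<in>{Cs \<in> {Cs \<in> osp ?A. deranged Cs}. length Cs = k}. osp_weight Cs)"
    using length_osp_le[of ?A] by (intro sum.group[symmetric]) (auto simp: finite_osp)
  also have "\<dots> = (\<Sum>k=0..n. yconst (Dseries $ k) * (\<Sum>Cs\<in>{Cs \<in> osp ?A. length Cs = k}. osp_weight Cs))"
    unfolding sum_deranged_osp[OF finite_atLeastAtMost, symmetric]
    by (intro sum.cong) auto
  finally have "(\<Sum>Cs\<in>{Cs \<in> osp ?A. deranged Cs}. osp_weight Cs) * ?f =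
      (\<Sum>k=0..n. yconst (Dseries $ k) * ((\<Sum>Cs\<in>{Cs \<in> osp ?A. length Cs = k}. osp_weight Cs) * ?f))"
    by (simp only: sum_distrib_right mult.assoc)
  also have "\<dots> = (fps_yconst Dseries oo Yseries) $ n"
    by (simp only: W fps_compose_nth fps_yconst_def fps_nth_Abs_fps)
  finally show "egf (\<lambda>n. \<Sum>Cs\<in>{Cs \<in> osp {1..n}. deranged Cs}. osp_weight Cs) $ n =
      (fps_yconst Dseries oo Yseries) $ n"
    by (simp only: egf_def fps_nth_Abs_fps)
qed

section \<open>The structure of unit interval parking functions\<close>

text \<open>Replaces the recursion by a condition on each car: every spot it drives past is taken
  initially or by an earlier car. The intersection with \<open>{1..n}\<close> is there because a
  preference may be 0 here.\<close>

lemma park_eq_Some_iff: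
  "park n occ as = Some ss \<longleftrightarrow>
    length ss = length as \<and> distinct ss \<and> set ss \<subseteq> {1..n} - occ \<and>
    (\<forall>i<length as. as ! i \<le> ss ! i \<and> {1..n} \<inter> {as ! i..<ss ! i} \<subseteq> occ \<union> set (take i ss))"
proof (induction as arbitrary: occ ss)
  case Nil
  then show ?case by auto
next
  case (Cons a as)
  show ?case
  proof (cases ss)
    case Nil
    then show ?thesis by (auto simp: Let_def)
  next
    case ss: (Cons t ts)
    let ?free = "{s \<in> {1..n}. a \<le> s \<and> s \<notin> occ}"
    have "?free \<noteq> {} \<and> Min ?free = t \<longleftrightarrow> t \<in> ?free \<and> (\<forall>s\<in>?free. t \<le> s)"
      by (cases "?free = {}") (simp_all add: Min_eq_iff del: Collect_empty_eq)
    also have "\<dots> \<longleftrightarrow> t \<in> {1..n} - occ \<and> a \<le> t \<and> {1..n} \<inter> {a..<t} \<subseteq> occ"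
    proof -
      have "(\<forall>s\<in>?free. t \<le> s) \<longleftrightarrow> {1..n} \<inter> {a..<t} \<subseteq> occ"
        by (simp add: subset_iff Ball_def flip: not_le) blast
      then show ?thesis by (simp, blast)
    qed
    finally have Min: "?free \<noteq> {} \<and> Min ?free = t \<longleftrightarrow>
      t \<in> {1..n} - occ \<and> a \<le> t \<and> {1..n} \<inter> {a..<t} \<subseteq> occ" .
    have "park n occ (a # as) = Some ss \<longleftrightarrow>
        (?free \<noteq> {} \<and> Min ?free = t) \<and> park n (insert t occ) as = Some ts"
      by (auto simp: Let_def ss)
    also have "\<dots> \<longleftrightarrow> length ss = length (a # as) \<and> distinct ss \<and> set ss \<subseteq> {1..n} - occ \<and>
      (\<forall>i<length (a # as). (a # as) ! i \<le> ss ! i \<and>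
        {1..n} \<inter> {(a # as) ! i..<ss ! i} \<subseteq> occ \<union> set (take i ss))"
    proof -
      have "insert t occ \<union> set (take i ts) = occ \<union> insert t (set (take i ts))" for i
        by simp
      moreover have "distinct ts \<and> set ts \<subseteq> {1..n} - insert t occ \<longleftrightarrow>
          distinct (t # ts) \<and> set ts \<subseteq> {1..n} - occ"
        by auto
      ultimately show ?thesis
        unfolding Min Cons.IH ss by (simp add: All_less_Suc2 del: Un_insert_left Un_insert_right) argo
    qed
    finally show ?thesis .
  qed
qed

text \<open>
  Car \<open>i\<close> parks on spot \<open>s i\<close>; if this is not its preference, the preferred spot was taken by an
  earlier car. For a bijection \<open>s\<close> this already forces \<open>s\<close> to be the outcome of the parking process.
\<close>

locale unit_spots =
  fixes n :: nat and \<alpha> :: "nat list" and s :: "nat \<Rightarrow> nat"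
  assumes length: "length \<alpha> = n"
    and bij: "bij_betw s {1..n} {1..n}"
    and unit: "i \<in> {1..n} \<Longrightarrow> \<alpha> ! (i - 1) = s i \<or>
      s i = Suc (\<alpha> ! (i - 1)) \<and> (\<exists>k\<in>{1..<i}. s k = \<alpha> ! (i - 1))"

text \<open>Distinct spots of \<open>n\<close> cars fill the street, which gives the bijection. A
  car displaced by one drove past its preferred spot, so an earlier car holds it.\<close>

lemma UPF_imp_unit_spots:
  assumes "\<alpha> \<in> UPF n"
  obtains s where "unit_spots n \<alpha> s"
proof -
  obtain ss where park: "park n {} \<alpha> = Some ss"
    using assms by (auto simp: UPF_def PF_def)
  have \<alpha>: "length \<alpha> = n" "set \<alpha> \<subseteq> {1..n}" "\<forall>i<n. ss ! i = \<alpha> ! i \<or> ss ! i = Suc (\<alpha> ! i)"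
    using assms park by (auto simp: UPF_def PF_def)
  have ss: "length ss = n" "distinct ss" "set ss \<subseteq> {1..n}"
    "\<And>i. i < n \<Longrightarrow> {1..n} \<inter> {\<alpha> ! i..<ss ! i} \<subseteq> set (take i ss)"
    using park by (auto simp: park_eq_Some_iff \<alpha>(1))
  define s where "s = (\<lambda>i. ss ! (i - 1))"
  have "set ss = {1..n}"
    using ss by (intro card_subset_eq) (auto simp: distinct_card)
  moreover have "set ss = s ` {1..n}"
  proof -
    have "ss = map s [1..<Suc n]"
      by (rule nth_equalityI) (auto simp: s_def ss(1) simp del: upt_Suc)
    then show ?thesis
      by (metis set_map set_upt atLeastLessThanSuc_atLeastAtMost)
  qed
  moreover have "inj_on s {1..n}"
    using ss(1,2) by (intro inj_onI) (auto simp: s_def nth_eq_iff_index_eq)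
  ultimately have "bij_betw s {1..n} {1..n}"
    by (simp add: bij_betw_def)
  moreover have "\<alpha> ! (i - 1) = s i \<or> s i = Suc (\<alpha> ! (i - 1)) \<and> (\<exists>k\<in>{1..<i}. s k = \<alpha> ! (i - 1))"
    if i: "i \<in> {1..n}" for i
  proof (rule disjCI)
    assume "\<not> (s i = Suc (\<alpha> ! (i - 1)) \<and> (\<exists>k\<in>{1..<i}. s k = \<alpha> ! (i - 1)))"
    moreover have "\<exists>k\<in>{1..<i}. s k = \<alpha> ! (i - 1)" if "s i = Suc (\<alpha> ! (i - 1))"
    proof -
      have "\<alpha> ! (i - 1) \<in> set \<alpha>"
        using i \<alpha>(1) by (intro nth_mem) auto
      then have "\<alpha> ! (i - 1) \<in> set (take (i - 1) ss)"
        using ss(4)[of "i - 1"] that i \<alpha>(2) by (auto simp: s_def)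
      then obtain j where "j < i - 1" "ss ! j = \<alpha> ! (i - 1)"
        by (auto simp: in_set_conv_nth)
      then show ?thesis
        by (intro bexI[of _ "Suc j"]) (auto simp: s_def)
    qed
    moreover have "i - 1 < n"
      using i by auto
    then have "s i = \<alpha> ! (i - 1) \<or> s i = Suc (\<alpha> ! (i - 1))"
      using \<alpha>(3) by (simp add: s_def)
    ultimately show "\<alpha> ! (i - 1) = s i"
      by argo
  qed
  ultimately show ?thesis
    using \<alpha>(1) by (intro that) (unfold_locales, auto)
qed

context unit_spots
begin

lemma s_mem: "i \<in> {1..n} \<Longrightarrow> s i \<in> {1..n}"
  using bij by (auto simp: bij_betw_def)

text \<open>The spots a car drives past are none or just its preferred one, which is taken earlier.
  Hence \<open>park_eq_Some_iff\<close> identifies \<open>s\<close> as the parking outcome.\<close>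

lemma mem_UPF: "\<alpha> \<in> UPF n"
proof -
  define ss where "ss = map s [1..<Suc n]"
  have nth: "ss ! i = s (Suc i)" if "i < n" for i
    using that by (simp add: ss_def del: upt_Suc)
  have ss: "length ss = n" "distinct ss" "set ss = {1..n}"
    using bij by (auto simp: ss_def bij_betw_def distinct_map atLeastLessThanSuc_atLeastAtMost simp del: upt_Suc)
  have unit': "\<alpha> ! i = ss ! i \<or> ss ! i = Suc (\<alpha> ! i) \<and> \<alpha> ! i \<in> set (take i ss)" if "i < n" for i
  proof -
    have "\<alpha> ! i \<in> set (take i ss)" if k: "k \<in> {1..<Suc i}" "s k = \<alpha> ! i" for k
    proof -
      have "take i ss ! (k - 1) = \<alpha> ! i" "k - 1 < length (take i ss)"
        using k \<open>i < n\<close> ss(1) by (auto simp: nth)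
      then show ?thesis by (metis nth_mem)
    qed
    then show ?thesis
      using unit[of "Suc i"] that by (auto simp: nth)
  qed
  have "x \<in> {1..n}" if x: "x \<in> set \<alpha>" for x
  proof -
    obtain i where i: "i < n" "x = \<alpha> ! i"
      using x by (auto simp: in_set_conv_nth length)
    then have "x \<in> set ss"
      using unit'[of i] ss(1) by (auto dest: in_set_takeD)
    then show ?thesis using ss(3) by simp
  qed
  moreover have "park n {} \<alpha> = Some ss"
  proof -
    have "\<alpha> ! i \<le> ss ! i \<and> {1..n} \<inter> {\<alpha> ! i..<ss ! i} \<subseteq> {} \<union> set (take i ss)" if "i < n" for i
      using unit'[OF that] by (auto simp: less_Suc_eq)
    then show ?thesis
      unfolding park_eq_Some_iff using ss by (auto simp: length)
  qed
  moreover have "the (park n {} \<alpha>) ! i \<in> {\<alpha> ! i, \<alpha> ! i + 1}" if "i < n" for i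
    using unit'[OF that] calculation(2) by auto
  ultimately show ?thesis
    using length by (auto simp: UPF_def PF_def)
qed

section \<open>Cars indexed by their spots, and the blocks\<close>

definition car :: "nat \<Rightarrow> nat" where
  "car = inv_into {1..n} s"

lemma car_mem: "t \<in> {1..n} \<Longrightarrow> car t \<in> {1..n}"
  using bij unfolding car_def bij_betw_def by (metis inv_into_into)

lemma s_car: "t \<in> {1..n} \<Longrightarrow> s (car t) = t"
  using bij unfolding car_def bij_betw_def by (metis f_inv_into_f)

lemma car_s: "i \<in> {1..n} \<Longrightarrow> car (s i) = i"
  using bij unfolding car_def bij_betw_def by (metis inv_into_f_f)

lemma inj_car: "inj_on car {1..n}"
  by (metis inj_onI s_car)

text \<open>Preferences in the order of spots instead of arrival; in this order they turn out to be
  sorted.\<close>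

abbreviation spot_pref :: "nat \<Rightarrow> nat" where
  "spot_pref t \<equiv> \<alpha> ! (car t - 1)"

lemma spot_pref_cases:
  assumes "t \<in> {1..n}"
  shows "spot_pref t = t \<or>
    t = Suc (spot_pref t) \<and> spot_pref t \<in> {1..n} \<and> car (spot_pref t) < car t"
proof -
  have "spot_pref t = t \<or> t = Suc (spot_pref t) \<and> (\<exists>k\<in>{1..<car t}. s k = spot_pref t)"
    using unit[OF car_mem[OF assms]] s_car[OF assms] by simp
  moreover have "spot_pref t \<in> {1..n} \<and> car (spot_pref t) < car t"
    if "k \<in> {1..<car t}" "s k = spot_pref t" for k
  proof -
    have "k \<in> {1..n}"
      using that car_mem[OF assms] by auto
    then show ?thesis
      using that car_s[of k] s_mem[of k] by simp
  qed
  ultimately show ?thesis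
    by blast
qed

text \<open>The car on spot \<open>t\<close> prefers \<open>t\<close> or \<open>t - 1\<close>, so
  for spots \<open>t < u\<close> the preferences satisfy
  \<open>spot_pref t \<le> t \<le> u - 1 \<le> spot_pref u\<close>.\<close>

lemma sort_eq: "sort \<alpha> = map spot_pref [1..<n + 1]"
proof (rule properties_for_sort)
  have "car ` {1..n} = {1..n}"
    using inj_car car_mem by (intro endo_inj_surj) auto
  then have perm: "image_mset car (mset_set {1..n}) = mset_set {1..n}"
    using inj_car by (simp add: image_mset_mset_set)
  have "\<alpha> = map (\<lambda>i. \<alpha> ! (i - 1)) [1..<n + 1]"
    by (rule nth_equalityI) (auto simp: length simp del: upt_Suc)
  then have "mset \<alpha> = image_mset (\<lambda>i. \<alpha> ! (i - 1)) (mset_set {1..n})"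
    by (metis mset_map mset_upt atLeastLessThanSuc_atLeastAtMost Suc_eq_plus1)
  also have "\<dots> = image_mset (\<lambda>i. \<alpha> ! (i - 1)) (image_mset car (mset_set {1..n}))"
    by (simp only: perm)
  also have "\<dots> = mset (map spot_pref [1..<n + 1])"
    by (simp add: atLeastLessThanSuc_atLeastAtMost multiset.map_comp comp_def del: upt_Suc)
  finally show "mset (map spot_pref [1..<n + 1]) = mset \<alpha>" ..
  have "spot_pref (Suc i) \<le> spot_pref (Suc j)" if "i \<le> j" "j < n" for i j
  proof (cases "i = j")
    case False
    have "spot_pref (Suc i) \<le> Suc i"
      using spot_pref_cases[of "Suc i"] that by auto
    moreover have "j \<le> spot_pref (Suc j)"
      using spot_pref_cases[of "Suc j"] that by auto
    ultimately show ?thesis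
      using that False by linarith
  qed simp
  then show "sorted (map spot_pref [1..<n + 1])"
    by (auto simp: sorted_iff_nth_mono simp del: upt_Suc)
qed

lemma block_starts_eq: "block_starts \<alpha> = filter (\<lambda>t. spot_pref t = t) [1..<n + 1]"
  unfolding block_starts_def length sort_eq
  by (rule filter_cong) (auto simp del: upt_Suc)

lemma set_block_starts: "set (block_starts \<alpha>) = {t \<in> {1..n}. spot_pref t = t}"
  by (auto simp: block_starts_eq simp del: upt_Suc)

lemma strict_sorted_block_bounds: "sorted_wrt (<) (block_bounds \<alpha>)"
  by (auto simp: block_bounds_def sorted_wrt_append block_starts_eq length sorted_wrt_filter
      simp del: upt_Suc)

lemma block_bounds_strict_mono:
  "j < l \<Longrightarrow> l \<le> num_blocks \<alpha> \<Longrightarrow> block_bounds \<alpha> ! j < block_bounds \<alpha> ! l"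
  using strict_sorted_block_bounds
  by (auto simp: sorted_wrt_iff_nth_less block_bounds_def num_blocks_def)

lemma block_bounds_last: "block_bounds \<alpha> ! num_blocks \<alpha> = Suc n"
  by (simp add: block_bounds_def num_blocks_def length)

lemma block_bounds_mem:
  assumes "j < num_blocks \<alpha>"
  shows "block_bounds \<alpha> ! j \<in> {1..n}" "spot_pref (block_bounds \<alpha> ! j) = block_bounds \<alpha> ! j"
proof -
  have "block_bounds \<alpha> ! j \<in> set (block_starts \<alpha>)"
    using assms by (simp add: block_bounds_def num_blocks_def nth_append)
  then show "block_bounds \<alpha> ! j \<in> {1..n}" "spot_pref (block_bounds \<alpha> ! j) = block_bounds \<alpha> ! j"
    unfolding set_block_starts by auto
qed

lemma block_bounds_Suc_le: "j < num_blocks \<alpha> \<Longrightarrow> block_bounds \<alpha> ! Suc j \<le> Suc n"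
  using block_bounds_mem[of "Suc j"] block_bounds_last
  by (cases "Suc j = num_blocks \<alpha>") auto

text \<open>The car on spot 1 cannot be displaced, since no spot 0 exists. For \<open>n = 0\<close>
  the entry is the closing bound \<open>n + 1\<close>.\<close>

lemma block_bounds_0: "block_bounds \<alpha> ! 0 = 1"
proof (cases "n = 0")
  case True
  then show ?thesis
    by (simp add: block_bounds_def block_starts_eq length)
next
  case False
  then have "spot_pref 1 = 1"
    using spot_pref_cases[of 1] by auto
  then have "block_starts \<alpha> = 1 # filter (\<lambda>t. spot_pref t = t) [2..<n + 1]"
    unfolding block_starts_eq using False by (subst upt_conv_Cons) (auto simp: numeral_2_eq_2)
  then show ?thesis
    by (simp add: block_bounds_def)
qed

text \<open>A block start strictly between two consecutive entries of the strictly increasing list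
  of bounds is impossible.\<close>

lemma not_block_start:
  assumes "j < num_blocks \<alpha>" "block_bounds \<alpha> ! j < t" "t < block_bounds \<alpha> ! Suc j"
  shows "spot_pref t \<noteq> t"
proof
  assume t: "spot_pref t = t"
  have "t \<in> {1..n}"
    using assms block_bounds_Suc_le[of j] by auto
  with t have "t \<in> set (block_starts \<alpha>)"
    by (simp add: set_block_starts)
  then obtain l where l: "l < num_blocks \<alpha>" "t = block_bounds \<alpha> ! l"
    by (auto simp: in_set_conv_nth num_blocks_def block_bounds_def nth_append)
  consider "l < j" | "l = j" | "l = Suc j" | "Suc j < l" by linarith
  then show False
    using l assms block_bounds_strict_mono[of l j] block_bounds_strict_mono[of "Suc j" l] by cases auto
qed

text \<open>Passes from preferences to spots. A displaced car never crosses a bound: its spot is not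
  a block start, so its preference lies in the same block.\<close>

lemma car_set_eq:
  assumes "j < num_blocks \<alpha>"
  shows "car_set \<alpha> j = {i \<in> {1..n}. s i \<in> {block_bounds \<alpha> ! j..<block_bounds \<alpha> ! Suc j}}"
proof -
  have "block_bounds \<alpha> ! j \<le> \<alpha> ! (i - 1) \<and> \<alpha> ! (i - 1) < block_bounds \<alpha> ! Suc j \<longleftrightarrow>
      block_bounds \<alpha> ! j \<le> s i \<and> s i < block_bounds \<alpha> ! Suc j"
    if i: "i \<in> {1..n}" for i
  proof (cases "\<alpha> ! (i - 1) = s i")
    case False
    have s: "s i = Suc (\<alpha> ! (i - 1))"
      using unit[OF i] False by blast
    have "s i \<noteq> block_bounds \<alpha> ! l" if "l < num_blocks \<alpha>" for l
      using block_bounds_mem(2)[OF that] False car_s[OF i] by auto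
    moreover have "s i \<noteq> Suc n"
      using s_mem[OF i] by auto
    ultimately have "s i \<noteq> block_bounds \<alpha> ! l" if "l \<le> num_blocks \<alpha>" for l
      using that block_bounds_last by (cases "l = num_blocks \<alpha>") auto
    from this[of j] this[of "Suc j"] show ?thesis
      using s assms by auto
  qed simp
  then show ?thesis
    by (auto simp: car_set_def length)
qed

text \<open>Every spot of a block after the first holds a displaced car, which arrived after the car
  on the preceding spot. Induction chains these comparisons.\<close>

lemma car_less_car:
  assumes "j < num_blocks \<alpha>" "block_bounds \<alpha> ! j \<le> t"
  shows "t < u \<Longrightarrow> u < block_bounds \<alpha> ! Suc j \<Longrightarrow> car t < car u"
proof (induction u)
  case (Suc u)
  have "Suc u \<in> {1..n}"
    using Suc.prems block_bounds_Suc_le[OF assms(1)] by auto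
  moreover have "spot_pref (Suc u) \<noteq> Suc u"
    using Suc.prems assms by (intro not_block_start) auto
  ultimately have "car u < car (Suc u)"
    using spot_pref_cases[of "Suc u"] by auto
  then show ?case
    using Suc by (cases "t = u") auto
qed simp

lemma car_set_eq_image:
  assumes "j < num_blocks \<alpha>"
  shows "car_set \<alpha> j = car ` {block_bounds \<alpha> ! j..<block_bounds \<alpha> ! Suc j}"
proof (intro equalityI subsetI)
  fix i assume "i \<in> car_set \<alpha> j"
  then show "i \<in> car ` {block_bounds \<alpha> ! j..<block_bounds \<alpha> ! Suc j}"
    unfolding car_set_eq[OF assms] using car_s by (metis (no_types, lifting) imageI mem_Collect_eq)
next
  fix i assume "i \<in> car ` {block_bounds \<alpha> ! j..<block_bounds \<alpha> ! Suc j}"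
  then obtain t where t: "i = car t" "t \<in> {block_bounds \<alpha> ! j..<block_bounds \<alpha> ! Suc j}" by auto
  then have "t \<in> {1..n}"
    using block_bounds_mem(1)[OF assms] block_bounds_Suc_le[OF assms] by auto
  then show "i \<in> car_set \<alpha> j"
    unfolding car_set_eq[OF assms] using t s_car car_mem by auto
qed

lemma inj_on_car:
  assumes "j < num_blocks \<alpha>"
  shows "inj_on car {block_bounds \<alpha> ! j..<block_bounds \<alpha> ! Suc j}"
  using block_bounds_mem(1)[OF assms] block_bounds_Suc_le[OF assms]
  by (intro inj_on_subset[OF inj_car]) auto

lemma card_car_set: "j < num_blocks \<alpha> \<Longrightarrow> card (car_set \<alpha> j) = block_length \<alpha> j"
  by (simp add: car_set_eq_image card_image inj_on_car block_length_def)

text \<open>Inside a block the cars park in increasing order, so the rank of a car gives its spot.\<close>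

lemma rank_car_set:
  assumes "j < num_blocks \<alpha>" "i \<in> car_set \<alpha> j"
  shows "card {x \<in> car_set \<alpha> j. x < i} = s i - block_bounds \<alpha> ! j"
proof -
  let ?a = "block_bounds \<alpha> ! j" and ?b = "block_bounds \<alpha> ! Suc j"
  have i: "i \<in> {1..n}" "s i \<in> {?a..<?b}"
    using assms by (auto simp: car_set_eq)
  have "car t < i \<longleftrightarrow> t < s i" if "t \<in> {?a..<?b}" for t
    using car_less_car[OF assms(1), of t "s i"] car_less_car[OF assms(1), of "s i" t] that i car_s[OF i(1)]
    by (cases t "s i" rule: linorder_cases) auto
  then have "{x \<in> car_set \<alpha> j. x < i} = car ` {?a..<s i}"
    using i(2) by (auto simp: car_set_eq_image[OF assms(1)])
  moreover have "inj_on car {?a..<s i}"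
    using i(2) by (intro inj_on_subset[OF inj_on_car[OF assms(1)]]) auto
  ultimately show ?thesis
    by (simp add: card_image)
qed

text \<open>The block lengths telescope from the first bound 1. Thus the bounds can be recovered
  from the car sets alone.\<close>

lemma block_bounds_eq_sum:
  "j \<le> num_blocks \<alpha> \<Longrightarrow> block_bounds \<alpha> ! j = Suc (\<Sum>l<j. card (car_set \<alpha> l))"
proof (induction j)
  case 0
  then show ?case by (simp add: block_bounds_0)
next
  case (Suc j)
  then show ?case
    using block_bounds_strict_mono[of j "Suc j"] by (simp add: card_car_set block_length_def)
qed

text \<open>The right-hand side involves only the car sets, which is what makes \<open>phi\<close>
  injective.\<close>

lemma pref_eq:
  assumes "j < num_blocks \<alpha>" "i \<in> car_set \<alpha> j"
  shows "\<alpha> ! (i - 1) = Suc (\<Sum>l<j. card (car_set \<alpha> l)) + (card {x \<in> car_set \<alpha> j. x < i} - 1)"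
proof -
  have i: "i \<in> {1..n}" "block_bounds \<alpha> ! j \<le> s i" "s i < block_bounds \<alpha> ! Suc j"
    using assms by (auto simp: car_set_eq)
  \<comment> \<open>Only the first car of a block gets its preference; the truncated
    \<open>- 1\<close> in the claim covers its rank 0.\<close>
  have "\<alpha> ! (i - 1) = (if s i = block_bounds \<alpha> ! j then s i else s i - 1)"
  proof (cases "s i = block_bounds \<alpha> ! j")
    case True
    then show ?thesis
      using block_bounds_mem(2)[OF assms(1)] car_s[OF i(1)] by simp
  next
    case False
    then have "\<alpha> ! (i - 1) \<noteq> s i"
      using not_block_start[OF assms(1), of "s i"] i car_s[OF i(1)] by simp
    then show ?thesis
      using unit[OF i(1)] False by simp
  qed
  then show ?thesis
    using i assms by (auto simp: rank_car_set simp flip: block_bounds_eq_sum)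
qed

lemma block_cover:
  assumes "t \<in> {1..n}"
  obtains j where "j < num_blocks \<alpha>" "t \<in> {block_bounds \<alpha> ! j..<block_bounds \<alpha> ! Suc j}"
proof -
  \<comment> \<open>The first bound beyond \<open>t\<close> closes the block sought. It exists
    because the last bound is \<open>n + 1\<close>, and it is not the initial bound, which equals
    1.\<close>
  define j where "j = (LEAST j. t < block_bounds \<alpha> ! j)"
  have last: "t < block_bounds \<alpha> ! num_blocks \<alpha>"
    using assms by (simp add: block_bounds_last)
  have "t < block_bounds \<alpha> ! j"
    unfolding j_def using last by (rule LeastI)
  moreover have "j \<le> num_blocks \<alpha>"
    unfolding j_def using last by (rule Least_le)
  moreover have "j \<noteq> 0"
    using \<open>t < block_bounds \<alpha> ! j\<close> assms block_bounds_0 by (cases j) auto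
  moreover have "block_bounds \<alpha> ! (j - 1) \<le> t"
    using not_less_Least[of "j - 1" "\<lambda>j. t < block_bounds \<alpha> ! j"] \<open>j \<noteq> 0\<close> by (auto simp: j_def)
  ultimately show ?thesis
    by (intro that[of "j - 1"]) auto
qed

lemma car_set_disjoint:
  assumes "i < num_blocks \<alpha>" "j < num_blocks \<alpha>" "i < j"
  shows "car_set \<alpha> i \<inter> car_set \<alpha> j = {}"
  using assms block_bounds_strict_mono[of "Suc i" j]
  by (cases "Suc i = j") (auto simp: car_set_eq)

lemma car_set_nonempty: "j < num_blocks \<alpha> \<Longrightarrow> car_set \<alpha> j \<noteq> {}"
  using block_bounds_strict_mono[of j "Suc j"] by (simp add: car_set_eq_image)

lemma phi_mem_osp: "phi \<alpha> \<in> osp {1..n}"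
proof -
  have disj: "car_set \<alpha> i \<inter> car_set \<alpha> j = {}"
    if "i < num_blocks \<alpha>" "j < num_blocks \<alpha>" "i \<noteq> j" for i j
    using that car_set_disjoint[of i j] car_set_disjoint[of j i] by (cases "i < j") auto
  have "inj_on (car_set \<alpha>) {..<num_blocks \<alpha>}"
    using disj car_set_nonempty by (intro inj_onI) (metis Int_absorb lessThan_iff)
  then have "distinct (phi \<alpha>)"
    by (simp add: phi_def distinct_map atLeast0LessThan)
  moreover have "\<Union> (set (phi \<alpha>)) = {1..n}"
  proof (intro equalityI subsetI)
    fix i assume i: "i \<in> {1..n}"
    then obtain j where "j < num_blocks \<alpha>" "s i \<in> {block_bounds \<alpha> ! j..<block_bounds \<alpha> ! Suc j}"
      using block_cover s_mem by metis
    then show "i \<in> \<Union> (set (phi \<alpha>))"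
      using i by (auto simp: phi_def car_set_eq)
  qed (auto simp: phi_def car_set_def length)
  moreover have "disjoint (set (phi \<alpha>))"
    using disj by (auto simp: phi_def disjoint_def) blast+
  moreover have "{} \<notin> set (phi \<alpha>)"
    using car_set_nonempty by (force simp: phi_def)
  ultimately show ?thesis
    by (simp add: osp_def partition_on_def)
qed

lemma yweight_eq: "yweight \<alpha> = osp_weight (phi \<alpha>)"
proof -
  have "yweight \<alpha> = (\<Prod>j<num_blocks \<alpha>. yvar (card (car_set \<alpha> j)))"
    unfolding yweight_def by (intro prod.cong) (auto simp: card_car_set)
  also have "\<dots> = osp_weight (phi \<alpha>)"
    by (simp add: phi_def prod.list_conv_set_nth atLeast0LessThan)
  finally show ?thesis .
qed

end

text \<open>Equal images give equal car sets, and \<open>pref_eq\<close> computes every entry from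
  these, whatever the spot functions \<open>s\<close> and \<open>t\<close> are.\<close>

lemma inj_on_phi: "inj_on phi (UPF n)"
proof (rule inj_onI)
  fix \<alpha> \<beta> assume *: "\<alpha> \<in> UPF n" "\<beta> \<in> UPF n" and phi: "phi \<alpha> = phi \<beta>"
  obtain s where "unit_spots n \<alpha> s" using *(1) by (rule UPF_imp_unit_spots)
  interpret a: unit_spots n \<alpha> s by fact
  obtain t where "unit_spots n \<beta> t" using *(2) by (rule UPF_imp_unit_spots)
  interpret b: unit_spots n \<beta> t by fact
  have m: "num_blocks \<alpha> = num_blocks \<beta>"
    using arg_cong[OF phi, of length] by (simp add: phi_def)
  have car_set: "car_set \<alpha> j = car_set \<beta> j" if "j < num_blocks \<alpha>" for j
    using arg_cong[OF phi, of "\<lambda>xs. xs ! j"] that by (simp add: phi_def flip: m)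
  show "\<alpha> = \<beta>"
  proof (rule nth_equalityI)
    show "length \<alpha> = length \<beta>" by (simp add: a.length b.length)
    fix i assume "i < length \<alpha>"
    then have "Suc i \<in> {1..n}" by (simp add: a.length)
    then obtain j where j: "j < num_blocks \<alpha>" "s (Suc i) \<in> {block_bounds \<alpha> ! j..<block_bounds \<alpha> ! Suc j}"
      using a.block_cover a.s_mem by metis
    then have "Suc i \<in> car_set \<alpha> j"
      using \<open>Suc i \<in> {1..n}\<close> by (simp add: a.car_set_eq)
    then show "\<alpha> ! i = \<beta> ! i"
      using a.pref_eq[of j "Suc i"] b.pref_eq[of j "Suc i"] j(1) m car_set by simp
  qed
qed

section \<open>The parking function of an ordered set partition\<close>

text \<open>Setting for the preimage of \<open>Cs\<close> under \<open>phi\<close>: the street is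
  filled block after block, each block by its cars in increasing order.\<close>

locale ordered_partition =
  fixes n :: nat and Cs :: "nat set list"
  assumes osp: "Cs \<in> osp {1..n}"
begin

lemma distinct: "distinct Cs" and partition: "partition_on {1..n} (set Cs)"
  using osp by (auto simp: osp_def)

lemma block_subset: "j < length Cs \<Longrightarrow> Cs ! j \<subseteq> {1..n}"
  using partition nth_mem by (auto simp: partition_on_def)

lemma finite_block: "j < length Cs \<Longrightarrow> finite (Cs ! j)"
  using block_subset finite_subset by blast

lemma block_nonempty: "j < length Cs \<Longrightarrow> Cs ! j \<noteq> {}"
  using partition nth_mem by (metis partition_on_def)

lemma block_unique:
  assumes "i \<in> Cs ! j" "i \<in> Cs ! l" "j < length Cs" "l < length Cs"
  shows "j = l"
proof -
  have "Cs ! j = Cs ! l"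
    using partition_onD2[OF partition] assms
    by (meson disjointD disjoint_iff nth_mem)
  then show ?thesis
    using distinct assms by (simp add: nth_eq_iff_index_eq)
qed

definition block :: "nat \<Rightarrow> nat" where
  "block i = (THE j. j < length Cs \<and> i \<in> Cs ! j)"

lemma block_eq: "i \<in> Cs ! j \<Longrightarrow> j < length Cs \<Longrightarrow> block i = j"
  unfolding block_def using block_unique by blast

lemma block:
  assumes "i \<in> {1..n}"
  shows "block i < length Cs" "i \<in> Cs ! block i"
proof -
  obtain j where "j < length Cs" "i \<in> Cs ! j"
    using assms partition_onD1[OF partition] by (metis UnionE in_set_conv_nth)
  then show "block i < length Cs" "i \<in> Cs ! block i"
    using block_eq by auto
qed

text \<open>The intended start of block \<open>j\<close>, with \<open>Suc\<close> because spots
  count from 1. At \<open>length Cs\<close> it becomes the closing bound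
  \<open>n + 1\<close>.\<close>

definition offset :: "nat \<Rightarrow> nat" where
  "offset j = Suc (\<Sum>l<j. card (Cs ! l))"

lemma offset_Suc: "offset (Suc j) = offset j + card (Cs ! j)"
  by (simp add: offset_def)

lemma offset_mono: "j \<le> l \<Longrightarrow> offset j \<le> offset l"
  unfolding offset_def by (simp add: sum_mono2)

lemma offset_strict_mono: "j < l \<Longrightarrow> l \<le> length Cs \<Longrightarrow> offset j < offset l"
  using offset_mono[of "Suc j" l] block_nonempty[of j] finite_block[of j] card_gt_0_iff[of "Cs ! j"]
  by (simp add: offset_Suc)

lemma offset_length: "offset (length Cs) = Suc n"
proof -
  have "(\<Sum>l<length Cs. card (Cs ! l)) = sum card (set Cs)"
    using distinct by (simp add: sum.distinct_set_conv_list sum_list_sum_nth atLeast0LessThan)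
  also have "\<dots> = card (\<Union> (set Cs))"
    using partition by (intro card_Union_disjoint[symmetric])
      (auto simp: partition_on_def disjoint_def pairwise_def disjnt_def intro: finite_subset)
  also have "\<dots> = n"
    using partition by (simp add: partition_on_def)
  finally show ?thesis by (simp add: offset_def)
qed

lemma offset_interval_unique:
  assumes "t \<in> {offset j..<offset (Suc j)}" "t \<in> {offset l..<offset (Suc l)}"
  shows "j = l"
  using assms offset_mono[of "Suc j" l] offset_mono[of "Suc l" j]
  by (cases j l rule: linorder_cases) auto

definition rank :: "nat \<Rightarrow> nat" where
  "rank i = card {x \<in> Cs ! block i. x < i}"

definition spot :: "nat \<Rightarrow> nat" where
  "spot i = offset (block i) + rank i"

text \<open>The subtraction truncates: the cars of rank 0 and 1 share the block start as preference.\<close>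

definition prefs :: "nat list" where
  "prefs = map (\<lambda>i. offset (block i) + (rank i - 1)) [1..<Suc n]"

lemma nth_prefs: "i \<in> {1..n} \<Longrightarrow> prefs ! (i - 1) = offset (block i) + (rank i - 1)"
  by (auto simp: prefs_def simp del: upt_Suc)

lemma rank_less: "i \<in> {1..n} \<Longrightarrow> rank i < card (Cs ! block i)"
  unfolding rank_def using block finite_block by (intro psubset_card_mono) auto

lemma spot_mem: "i \<in> {1..n} \<Longrightarrow> spot i \<in> {offset (block i)..<offset (Suc (block i))}"
  using rank_less by (simp add: spot_def offset_Suc)

lemma rank_less_rank:
  assumes "i \<in> Cs ! j" "k \<in> Cs ! j" "j < length Cs" "i < k"
  shows "rank i < rank k"
  unfolding rank_def using assms finite_block
  by (intro psubset_card_mono) (auto simp: block_eq)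

text \<open>The disjoint offset intervals recover the block from the spot, and ranks strictly
  increase within a block.\<close>

lemma inj_on_spot: "inj_on spot {1..n}"
proof (rule inj_onI)
  fix i k assume ik: "i \<in> {1..n}" "k \<in> {1..n}" "spot i = spot k"
  have b: "block i = block k"
    using spot_mem[OF ik(1)] spot_mem[OF ik(2)] ik(3) offset_interval_unique by metis
  then have "rank i = rank k"
    using ik by (simp add: spot_def)
  then show "i = k"
    using rank_less_rank[of i "block i" k] rank_less_rank[of k "block i" i]
      block[OF ik(1)] block[OF ik(2)] b
    by (cases i k rule: linorder_cases) auto
qed

lemma bij_betw_spot: "bij_betw spot {1..n} {1..n}"
proof -
  have "spot i \<in> {1..n}" if "i \<in> {1..n}" for i
    using spot_mem[OF that] block(1)[OF that] offset_mono[of "Suc (block i)" "length Cs"]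
      offset_mono[of 0 "block i"]
    by (auto simp: offset_length) (simp add: offset_def)
  then have "spot ` {1..n} = {1..n}"
    using inj_on_spot by (intro endo_inj_surj) auto
  then show ?thesis
    using inj_on_spot by (simp add: bij_betw_def)
qed

text \<open>The largest smaller member of the same block has rank one less. It supplies the earlier
  car on the preferred spot that \<open>unit_spots\<close> demands.\<close>

lemma rank_pred:
  assumes "i \<in> {1..n}" "rank i > 0"
  obtains k where "k \<in> {1..<i}" "spot i = Suc (spot k)"
proof -
  let ?C = "Cs ! block i" and ?S = "{x \<in> Cs ! block i. x < i}"
  define k where "k = Max ?S"
  have fin: "finite ?S" using finite_block block(1)[OF assms(1)] by simp
  have "?S \<noteq> {}" using assms(2) by (metis card.empty less_irrefl rank_def)
  then have k: "k \<in> ?C" "k < i"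
    using Max_in[OF fin] by (auto simp: k_def)
  have b: "block k = block i"
    using k(1) block(1)[OF assms(1)] by (rule block_eq)
  have "?S = insert k {x \<in> ?C. x < k}"
    using k Max_ge[OF fin] by (auto simp: k_def[symmetric] le_less)
  then have "rank i = Suc (rank k)"
    using fin by (simp add: rank_def b)
  then show ?thesis
    using k b block_subset[OF block(1)[OF assms(1)]] by (intro that[of k]) (auto simp: spot_def)
qed

text \<open>Makes the whole block theory available for \<open>prefs\<close>, including membership in
  \<open>UPF n\<close>. A car of rank 0 is not displaced; any other is displaced by one.\<close>

sublocale unit_spots n prefs spot
proof
  show "length prefs = n" by (simp add: prefs_def del: upt_Suc)
  show "bij_betw spot {1..n} {1..n}" by (rule bij_betw_spot)
  fix i assume i: "i \<in> {1..n}"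
  show "prefs ! (i - 1) = spot i \<or>
    spot i = Suc (prefs ! (i - 1)) \<and> (\<exists>k\<in>{1..<i}. spot k = prefs ! (i - 1))"
  proof (cases "rank i = 0")
    case True
    then show ?thesis using nth_prefs[OF i] by (simp add: spot_def)
  next
    case False
    then have "spot i = Suc (prefs ! (i - 1))"
      using nth_prefs[OF i] by (simp add: spot_def)
    moreover obtain k where "k \<in> {1..<i}" "spot i = Suc (spot k)"
      using rank_pred[OF i] False by blast
    ultimately show ?thesis by auto
  qed
qed

text \<open>Preference and spot agree exactly at rank 0, that is, for the minimum of each block,
  which parks at the offset.\<close>

lemma set_block_starts_prefs: "set (block_starts prefs) = offset ` {..<length Cs}"
proof (intro equalityI subsetI)
  fix t assume "t \<in> set (block_starts prefs)"
  then have t: "t \<in> {1..n}" "spot_pref t = t"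
    by (auto simp: set_block_starts)
  have "rank (car t) = 0"
    using t nth_prefs[OF car_mem[OF t(1)]] s_car[OF t(1)] by (simp add: spot_def)
  then have "t = offset (block (car t))"
    using s_car[OF t(1)] by (simp add: spot_def)
  then show "t \<in> offset ` {..<length Cs}"
    using block(1)[OF car_mem[OF t(1)]] by blast
next
  fix t assume "t \<in> offset ` {..<length Cs}"
  then obtain j where j: "j < length Cs" "t = offset j" by auto
  define i where "i = Min (Cs ! j)"
  have i: "i \<in> Cs ! j"
    unfolding i_def using j finite_block block_nonempty by (intro Min_in) auto
  then have i': "i \<in> {1..n}" "block i = j"
    using j block_subset[OF j(1)] block_eq by auto
  have "{x \<in> Cs ! j. x < i} = {}"
    using Min_le[OF finite_block[OF j(1)]] by (auto simp: i_def not_less)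
  then have "rank i = 0"
    by (simp add: rank_def i')
  then have "spot i = t" "prefs ! (i - 1) = t"
    using j i' nth_prefs[OF i'(1)] by (simp_all add: spot_def)
  then show "t \<in> set (block_starts prefs)"
    using s_mem[OF i'(1)] car_s[OF i'(1)] by (auto simp: set_block_starts)
qed

lemma block_starts_prefs: "block_starts prefs = map offset [0..<length Cs]"
proof (rule sorted_distinct_set_unique)
  have strict: "sorted_wrt (<) (map offset [0..<length Cs])"
    by (auto simp: sorted_wrt_iff_nth_less offset_strict_mono)
  then show "sorted (map offset [0..<length Cs])" "distinct (map offset [0..<length Cs])"
    by (simp_all only: strict_sorted_iff)
  show "sorted (block_starts prefs)" "distinct (block_starts prefs)"
    by (auto simp: block_starts_eq sorted_wrt_filter simp del: upt_Suc)
  show "set (block_starts prefs) = set (map offset [0..<length Cs])"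
    by (simp add: set_block_starts_prefs atLeast0LessThan)
qed

lemma num_blocks_prefs: "num_blocks prefs = length Cs"
  by (simp add: num_blocks_def block_starts_prefs)

lemma block_bounds_prefs: "j \<le> length Cs \<Longrightarrow> block_bounds prefs ! j = offset j"
  using offset_length by (auto simp: block_bounds_def block_starts_prefs length nth_append)

text \<open>By \<open>car_set_eq\<close> car sets can be read off from spots, and
  \<open>spot i\<close> lies in the offset interval of \<open>block i\<close> and in no
  other.\<close>

lemma phi_prefs: "phi prefs = Cs"
proof (rule nth_equalityI)
  show "length (phi prefs) = length Cs"
    by (simp add: phi_def num_blocks_prefs)
  fix j assume "j < length (phi prefs)"
  then have j: "j < length Cs"
    by (simp add: phi_def num_blocks_prefs)
  have "car_set prefs j = {i \<in> {1..n}. spot i \<in> {offset j..<offset (Suc j)}}"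
    using j by (simp add: car_set_eq num_blocks_prefs block_bounds_prefs)
  also have "\<dots> = {i \<in> {1..n}. block i = j}"
    using spot_mem offset_interval_unique by blast
  also have "\<dots> = Cs ! j"
    using j block block_eq block_subset by blast
  finally show "phi prefs ! j = Cs ! j"
    using j by (simp add: phi_def num_blocks_prefs)
qed

end

section \<open>The bijection and the generating function identity\<close>

lemma bij_betw_phi: "bij_betw phi (UPF n) (osp {1..n})"
proof (rule bij_betw_imageI[OF inj_on_phi], intro equalityI subsetI)
  fix Cs assume "Cs \<in> phi ` UPF n"
  then obtain \<alpha> where "\<alpha> \<in> UPF n" "Cs = phi \<alpha>" by blast
  then show "Cs \<in> osp {1..n}"
    by (metis UPF_imp_unit_spots unit_spots.phi_mem_osp)
next
  fix Cs :: "nat set list" assume "Cs \<in> osp {1..n}"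
  then interpret ordered_partition n Cs by unfold_locales
  show "Cs \<in> phi ` UPF n"
    using phi_prefs mem_UPF by force
qed

theorem theorem4p10:
  "egf (\<lambda>n. \<Sum>\<alpha>\<in>DUPF n. yweight \<alpha>) =
   fps_compose (fps_yconst Dseries) (egf (\<lambda>j. if j \<ge> 1 then yvar j else 0))"
proof -
  have "(\<Sum>\<alpha>\<in>DUPF n. yweight \<alpha>) = (\<Sum>Cs\<in>{Cs \<in> osp {1..n}. deranged Cs}. osp_weight Cs)" for n
  proof -
    have "(\<Sum>\<alpha>\<in>DUPF n. yweight \<alpha>) = (\<Sum>\<alpha>\<in>DUPF n. osp_weight (phi \<alpha>))"
      by (intro sum.cong refl) (metis DUPF_def UPF_imp_unit_spots mem_Collect_eq unit_spots.yweight_eq)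
    \<comment> \<open>The derangement condition in \<open>DUPF\<close> depends on
      \<open>phi \<alpha>\<close> alone, so the bijection restricts to the deranged ordered
      partitions.\<close>
    also have "\<dots> = (\<Sum>Cs\<in>{Cs \<in> osp {1..n}. deranged Cs}. osp_weight Cs)"
      using bij_betw_phi[of n]
      by (intro sum.reindex_bij_betw) (auto simp: bij_betw_def DUPF_def inj_on_def)
    finally show ?thesis .
  qed
  then show ?thesis
    by (simp only: egf_deranged_osp Yseries_def)
qed

end
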